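(* For all $n \ge 1$, \[ \left| \mathcal{CI}_{2n}(1243,2143) \right| = \left| \mathcal{CI}_{2n+1}(1243,2143) \right| = p_n, \] where $p_n$ denotes the $n$-th Pell number, i.e., $p_1=2$, $p_2=5$ and $p_n = 2p_{n-1} + p_{n-2}$ for every $n \ge 3$.
   Context: $\mathfrak{S}_m$ is the set of permutations of $\{1,\ldots,m\}$. The reverse-complement of $\pi\in\mathfrak{S}_m$ is $\mathrm{rc}(\pi)=\pi'$ with $\pi'(i)=(m+1)-\pi(m+1-i)$ for $i=1,\ldots,m$; $\pi$ is centrosymmetric if $\mathrm{rc}(\pi)=\pi$. $\mathcal{CI}_m(1243,2143)$ denotes the set of centrosymmetric involutions ($\pi=\pi^{-1}$ and $\mathrm{rc}(\pi)=\pi$) in $\mathfrak{S}_m$ that avoid both $1243$ and $2143$, i.e. contain no subsequence order-isomorphic to $1243$ or to $2143$. The indexing of the Pell numbers is the one given by the stated initial values. *)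

theory Defs
  imports "HOL-Combinatorics.Permutations"
begin

text \<open>
  A permutation of \<open>{1..m}\<close> is a function \<open>\<pi>\<close> with \<open>\<pi> permutes {1..m}\<close>; it is the identity
  outside \<open>{1..m}\<close>. Accordingly, the reverse-complement is made the identity there as well, so
  that \<open>rc m \<pi> = \<pi>\<close> depends only on the values on \<open>{1..m}\<close>.
\<close>

definition rc :: "nat \<Rightarrow> (nat \<Rightarrow> nat) \<Rightarrow> nat \<Rightarrow> nat" where
  "rc m \<pi> = (\<lambda>i. if i \<in> {1..m} then (m + 1) - \<pi> (m + 1 - i) else i)"

definition centrosymmetric :: "nat \<Rightarrow> (nat \<Rightarrow> nat) \<Rightarrow> bool" where
  "centrosymmetric m \<pi> \<longleftrightarrow> rc m \<pi> = \<pi>"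

text \<open>
  A pattern is given in one-line notation as a list. The function \<open>f\<close> selects, in increasing
  order, the positions of a subsequence of \<open>\<pi> 1, \<dots>, \<pi> m\<close> that is order-isomorphic to \<open>\<tau>\<close>.
\<close>

definition contains_pattern :: "nat \<Rightarrow> (nat \<Rightarrow> nat) \<Rightarrow> nat list \<Rightarrow> bool" where
  "contains_pattern m \<pi> \<tau> \<longleftrightarrow>
     (\<exists>f. strict_mono_on {..<length \<tau>} f \<and> f ` {..<length \<tau>} \<subseteq> {1..m} \<and>
          (\<forall>a<length \<tau>. \<forall>b<length \<tau>. \<pi> (f a) < \<pi> (f b) \<longleftrightarrow> \<tau> ! a < \<tau> ! b))"

definition CI :: "nat \<Rightarrow> nat list set \<Rightarrow> (nat \<Rightarrow> nat) set" where
  "CI m T = {\<pi>. \<pi> permutes {1..m} \<and> \<pi> = inv \<pi> \<and> centrosymmetric m \<pi> \<and>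
                (\<forall>\<tau>\<in>T. \<not> contains_pattern m \<pi> \<tau>)}"

text \<open>
  The value at \<open>0\<close> extends the recurrence backwards from \<open>pell 1 = 2\<close> and \<open>pell 2 = 5\<close>.
\<close>

fun pell :: "nat \<Rightarrow> nat" where
  "pell 0 = 1"
| "pell (Suc 0) = 2"
| "pell (Suc (Suc n)) = 2 * pell (Suc n) + pell n"

end

theory Submission
  imports Defs
begin

text \<open>
  Draw \<open>\<pi>\<close> as the points \<open>(i, \<pi> i)\<close>. It avoids 1243 and 2143 exactly when every inversion
  \<open>i < j\<close>, \<open>\<pi> j < \<pi> i\<close> has at most one point to the south-west of both of its points: two such points
  form the initial 12 or 21 of one of the patterns. The proof works with the bound \<open>k\<close> on this
  number of points in place of patterns; \<open>k = 1\<close> is the avoidance of 1243 and 2143, and \<open>k = 0\<close> is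
  the avoidance of 132. A centrosymmetric involution is an involution that is also symmetric under
  reflection in the antidiagonal, the latter being the equation \<open>rc m \<pi> = inv \<pi>\<close>. Dropping the
  involution property and keeping the symmetry in the antidiagonal gives a class that admits a
  simple decomposition.

  Let \<open>k \<le> 1\<close>, let \<open>\<pi>\<close> be symmetric in the antidiagonal with bound \<open>k\<close>, and write
  \<open>\<pi> 1 = m + 1 - a\<close>. Then \<open>\<pi> a = m\<close>, and the first \<open>a\<close> positions carry exactly the \<open>a\<close> largest
  values (\<open>first_block_high\<close>). So \<open>\<pi>\<close> is a skew sum of a block \<open>\<sigma>\<close> of size \<open>a\<close> that fixes 1 and of a
  permutation of size \<open>m - a\<close>, and both belong to the same class. If \<open>\<pi>\<close> is an involution, then either
  \<open>\<pi> 1 = 1\<close>, or \<open>\<pi>\<close> is the skew sum of \<open>\<sigma>\<close>, a smaller involution of the class, and \<open>inv \<sigma>\<close>.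

  A block of size at least 2 fixes its first and last point. Removing these two points lowers every
  count of south-west points by one, so that the blocks for \<open>k = 1\<close> of size \<open>m + 2\<close> correspond to the
  whole class for \<open>k = 0\<close> and size \<open>m\<close> (\<open>bij_betw_frame\<close>). For \<open>k = 0\<close> the only blocks are
  identities, and the decomposition gives \<open>2 ^ (m - 1)\<close> permutations of size \<open>m \<ge> 1\<close> and
  \<open>2 ^ (m div 2)\<close> involutions.

  Hence the number \<open>p n\<close> of centrosymmetric involutions of size \<open>2 * n\<close> or \<open>2 * n + 1\<close> that avoid
  both patterns satisfies
  \<open>p n = p (n - 1) + p (n - 2) + (2 ^ (n - 1) + (\<Sum>a = 3..n. 2 ^ (a - 3) * p (n - a)))\<close> for
  \<open>n \<ge> 2\<close>. The bracket doubles and gains \<open>p (n - 2)\<close> when \<open>n\<close> grows by one, which is the recurrence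
  of the Pell numbers; it is therefore equal to \<open>p (n - 1)\<close>, and \<open>p n = 2 * p (n - 1) + p (n - 2)\<close>.
\<close>

\<comment> \<open>Sizes and positions are kept in the forms \<open>1\<close> and \<open>m + 2\<close> throughout.\<close>
declare One_nat_def [simp del] add_2_eq_Suc' [simp del]

section \<open>Points south-west of an inversion\<close>

definition southwest :: "(nat \<Rightarrow> nat) \<Rightarrow> nat \<Rightarrow> nat \<Rightarrow> nat set" where
  "southwest \<pi> i j = {x. 1 \<le> x \<and> x < i \<and> \<pi> x < \<pi> j}"

definition sw_bounded :: "nat \<Rightarrow> nat \<Rightarrow> (nat \<Rightarrow> nat) \<Rightarrow> bool" where
  "sw_bounded k m \<pi> \<longleftrightarrow>
     (\<forall>i j. 1 \<le> i \<and> i < j \<and> j \<le> m \<and> \<pi> j < \<pi> i \<longrightarrow> card (southwest \<pi> i j) \<le> k)"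

lemma finite_southwest [simp]: "finite (southwest \<pi> i j)"
  by (rule finite_subset [of _ "{..<i}"]) (auto simp: southwest_def)

lemma sw_boundedD:
  "sw_bounded k m \<pi> \<Longrightarrow> 1 \<le> i \<Longrightarrow> i < j \<Longrightarrow> j \<le> m \<Longrightarrow> \<pi> j < \<pi> i \<Longrightarrow> card (southwest \<pi> i j) \<le> k"
  by (auto simp: sw_bounded_def)

text \<open>
  Transposing the diagram turns inversions into inversions and keeps the south-west quadrant.
\<close>
lemma sw_bounded_inv:
  assumes p: "\<pi> permutes {1..m}" and s: "sw_bounded k m \<pi>"
  shows "sw_bounded k m (inv \<pi>)"
  unfolding sw_bounded_def
proof (intro allI impI, elim conjE)
  fix i j :: nat
  assume ij: "1 \<le> i" "i < j" "j \<le> m" "inv \<pi> j < inv \<pi> i"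
  have inv_in: "inv \<pi> x \<in> {1..m}" if "x \<in> {1..m}" for x
    using permutes_in_image [OF permutes_inv [OF p]] that by blast
  have [simp]: "\<pi> (inv \<pi> x) = x" "inv \<pi> (\<pi> x) = x" for x
    using permutes_inverses [OF p] by auto
  have "southwest (inv \<pi>) i j = \<pi> ` southwest \<pi> (inv \<pi> j) (inv \<pi> i)"
  proof (intro set_eqI iffI)
    fix x assume "x \<in> southwest (inv \<pi>) i j"
    then have "inv \<pi> x \<in> southwest \<pi> (inv \<pi> j) (inv \<pi> i)"
      using ij inv_in [of x] by (auto simp: southwest_def)
    then show "x \<in> \<pi> ` southwest \<pi> (inv \<pi> j) (inv \<pi> i)"
      by (metis image_eqI \<open>\<And>x. \<pi> (inv \<pi> x) = x\<close>)
  next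
    fix x assume "x \<in> \<pi> ` southwest \<pi> (inv \<pi> j) (inv \<pi> i)"
    then obtain y where y: "x = \<pi> y" "1 \<le> y" "y < inv \<pi> j" "\<pi> y < i"
      by (auto simp: southwest_def)
    have "y \<in> {1..m}" using y inv_in [of j] ij by auto
    then have "\<pi> y \<in> {1..m}" using permutes_in_image [OF p] by blast
    then show "x \<in> southwest (inv \<pi>) i j"
      using y by (auto simp: southwest_def)
  qed
  then have "card (southwest (inv \<pi>) i j) \<le> card (southwest \<pi> (inv \<pi> j) (inv \<pi> i))"
    by (simp add: card_image_le)
  also have "\<dots> \<le> k"
    by (rule sw_boundedD [OF s]) (use ij inv_in [of i] inv_in [of j] in auto)
  finally show "card (southwest (inv \<pi>) i j) \<le> k" .
qed

section \<open>Skew sums\<close>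

text \<open>
  The block \<open>\<sigma>\<close> of size \<open>a\<close> lies to the north-west of the block \<open>\<tau>\<close> of size \<open>b\<close>.
\<close>
definition skew_sum :: "nat \<Rightarrow> nat \<Rightarrow> (nat \<Rightarrow> nat) \<Rightarrow> (nat \<Rightarrow> nat) \<Rightarrow> nat \<Rightarrow> nat" where
  "skew_sum a b \<sigma> \<tau> =
     (\<lambda>i. if i \<in> {1..a} then b + \<sigma> i else if i \<in> {a+1..a+b} then \<tau> (i - a) else i)"

lemma inv_of_inverse_pair: "(\<And>x. f (g x) = x) \<Longrightarrow> (\<And>x. g (f x) = x) \<Longrightarrow> inv f = g"
  by (rule inv_equality) auto

lemma permutes_range: "\<pi> permutes {1..m} \<Longrightarrow> 1 \<le> i \<Longrightarrow> i \<le> m \<Longrightarrow> 1 \<le> \<pi> i \<and> \<pi> i \<le> m"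
  by (metis atLeastAtMost_iff permutes_in_image)

lemma skew_sum_inverse:
  assumes s: "\<sigma> permutes {1..a}" and t: "\<tau> permutes {1..b}"
  shows "skew_sum b a (inv \<tau>) (inv \<sigma>) (skew_sum a b \<sigma> \<tau> x) = x"
proof -
  note [simp] = permutes_inverses [OF s] permutes_inverses [OF t]
  consider "x \<in> {1..a}" | "x \<in> {a+1..a+b}" | "x \<notin> {1..a+b}" by fastforce
  then show ?thesis
  proof cases
    case 1
    then show ?thesis using permutes_range [OF s, of x] by (auto simp: skew_sum_def)
  next
    case 2
    define y where "y = x - a"
    have "x = a + y" "1 \<le> y" "y \<le> b" using 2 by (auto simp: y_def)
    then show ?thesis using permutes_range [OF t, of y] by (auto simp: skew_sum_def)
  next
    case 3
    then show ?thesis by (auto simp: skew_sum_def)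
  qed
qed

lemma inv_skew_sum:
  assumes s: "\<sigma> permutes {1..a}" and t: "\<tau> permutes {1..b}"
  shows "inv (skew_sum a b \<sigma> \<tau>) = skew_sum b a (inv \<tau>) (inv \<sigma>)"
  using skew_sum_inverse [OF s t] skew_sum_inverse [OF permutes_inv [OF t] permutes_inv [OF s]]
  by (intro inv_of_inverse_pair) (simp_all add: permutes_inv_inv [OF s] permutes_inv_inv [OF t])

lemma skew_sum_permutes:
  assumes s: "\<sigma> permutes {1..a}" and t: "\<tau> permutes {1..b}"
  shows "skew_sum a b \<sigma> \<tau> permutes {1..a+b}"
proof -
  have "bij (skew_sum a b \<sigma> \<tau>)"
    using skew_sum_inverse [OF s t] skew_sum_inverse [OF permutes_inv [OF t] permutes_inv [OF s]]
    by (intro o_bij [of "skew_sum b a (inv \<tau>) (inv \<sigma>)"])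
       (auto simp: fun_eq_iff permutes_inv_inv [OF s] permutes_inv_inv [OF t])
  then show ?thesis
    by (auto simp: permutes_def bij_iff skew_sum_def)
qed

lemma skew_sum_inject:
  assumes eq: "skew_sum a b \<sigma> \<tau> = skew_sum a b \<sigma>' \<tau>'"
    and out: "\<And>i. i \<notin> {1..a} \<Longrightarrow> \<sigma> i = i" "\<And>i. i \<notin> {1..a} \<Longrightarrow> \<sigma>' i = i"
      "\<And>i. i \<notin> {1..b} \<Longrightarrow> \<tau> i = i" "\<And>i. i \<notin> {1..b} \<Longrightarrow> \<tau>' i = i"
  shows "\<sigma> = \<sigma>' \<and> \<tau> = \<tau>'"
proof (intro conjI ext)
  fix i
  show "\<sigma> i = \<sigma>' i"
    using fun_cong [OF eq, of i] out(1,2) [of i]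
    by (cases "i \<in> {1..a}") (auto simp: skew_sum_def)
  show "\<tau> i = \<tau>' i"
    using fun_cong [OF eq, of "a + i"] out(3,4) [of i]
    by (cases "i \<in> {1..b}") (auto simp: skew_sum_def)
qed

lemma skew_sum_assoc:
  "skew_sum (a + b) c (skew_sum a b \<rho> \<sigma>) \<tau> = skew_sum a (b + c) \<rho> (skew_sum b c \<sigma> \<tau>)"
  by (rule ext) (auto simp: skew_sum_def)

lemma rc_skew_sum:
  assumes s: "\<sigma> permutes {1..a}" and t: "\<tau> permutes {1..b}"
  shows "rc (a + b) (skew_sum a b \<sigma> \<tau>) = skew_sum b a (rc b \<tau>) (rc a \<sigma>)"
proof
  fix i
  consider "i \<in> {1..b}" | "i \<in> {b+1..b+a}" | "i \<notin> {1..a+b}" by fastforce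
  then show "rc (a + b) (skew_sum a b \<sigma> \<tau>) i = skew_sum b a (rc b \<tau>) (rc a \<sigma>) i"
  proof cases
    case 1
    define j where "j = b + 1 - i"
    have j: "j \<in> {1..b}" "a + b + 1 - i = a + j" using 1 by (auto simp: j_def)
    have "rc (a + b) (skew_sum a b \<sigma> \<tau>) i = a + b + 1 - skew_sum a b \<sigma> \<tau> (a + j)"
      using 1 j by (simp add: rc_def)
    also have "\<dots> = a + (b + 1 - \<tau> j)"
      using j permutes_range [OF t, of j] by (simp add: skew_sum_def)
    also have "\<dots> = skew_sum b a (rc b \<tau>) (rc a \<sigma>) i"
      using 1 by (simp add: skew_sum_def rc_def j_def)
    finally show ?thesis .
  next
    case 2
    define i' j where "i' = i - b" and "j = a + 1 - i'"
    have i': "i = b + i'" "i' \<in> {1..a}" and j: "j \<in> {1..a}" "a + b + 1 - i = j"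
      using 2 by (auto simp: i'_def j_def)
    have "rc (a + b) (skew_sum a b \<sigma> \<tau>) i = a + b + 1 - skew_sum a b \<sigma> \<tau> j"
      using 2 j by (simp add: rc_def)
    also have "\<dots> = a + 1 - \<sigma> j" using j by (simp add: skew_sum_def)
    also have "\<dots> = skew_sum b a (rc b \<tau>) (rc a \<sigma>) i"
      using i' by (simp add: skew_sum_def rc_def j_def)
    finally show ?thesis .
  next
    case 3
    then show ?thesis by (auto simp: skew_sum_def rc_def)
  qed
qed

text \<open>
  No point of one block is south-west of a point of the other block. So an inversion inside a block
  sees only its own block, and an inversion between the two blocks has no point to its south-west.
\<close>
lemma southwest_skew_sum_left:
  "i \<le> a \<Longrightarrow> j \<in> {1..a} \<Longrightarrow> southwest (skew_sum a b \<sigma> \<tau>) i j = southwest \<sigma> i j"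
  by (auto simp: southwest_def skew_sum_def)

lemma southwest_skew_sum_right:
  assumes t: "\<tau> permutes {1..b}" and i: "i \<in> {1..b}" and j: "j \<in> {1..b}"
  shows "southwest (skew_sum a b \<sigma> \<tau>) (a + i) (a + j) = (+) a ` southwest \<tau> i j"
proof (intro set_eqI iffI)
  fix x assume x: "x \<in> southwest (skew_sum a b \<sigma> \<tau>) (a + i) (a + j)"
  then have "a < x" using permutes_range [OF t, of j] j i
    by (auto simp: southwest_def skew_sum_def split: if_splits)
  then have "x - a \<in> southwest \<tau> i j" "x = a + (x - a)"
    using x i j by (auto simp: southwest_def skew_sum_def split: if_splits)
  then show "x \<in> (+) a ` southwest \<tau> i j" by blast
qed (use i j in \<open>auto simp: southwest_def skew_sum_def\<close>)

lemma southwest_skew_sum_mixed: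
  assumes t: "\<tau> permutes {1..b}" and "i \<le> a" and j: "j \<in> {1..b}"
  shows "southwest (skew_sum a b \<sigma> \<tau>) i (a + j) = {}"
  using assms permutes_range [OF t, of j] by (auto simp: southwest_def skew_sum_def)

lemma sw_bounded_skew_sum:
  assumes t: "\<tau> permutes {1..b}"
  shows "sw_bounded k (a + b) (skew_sum a b \<sigma> \<tau>) \<longleftrightarrow> sw_bounded k a \<sigma> \<and> sw_bounded k b \<tau>"
proof (intro iffI conjI)
  assume S: "sw_bounded k (a + b) (skew_sum a b \<sigma> \<tau>)"
  show "sw_bounded k a \<sigma>"
    unfolding sw_bounded_def
  proof (intro allI impI, elim conjE)
    fix i j assume ij: "1 \<le> i" "i < j" "j \<le> a" "\<sigma> j < \<sigma> i"
    have "card (southwest (skew_sum a b \<sigma> \<tau>) i j) \<le> k"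
      by (rule sw_boundedD [OF S]) (use ij in \<open>auto simp: skew_sum_def\<close>)
    then show "card (southwest \<sigma> i j) \<le> k"
      using ij by (simp add: southwest_skew_sum_left)
  qed
  show "sw_bounded k b \<tau>"
    unfolding sw_bounded_def
  proof (intro allI impI, elim conjE)
    fix i j assume ij: "1 \<le> i" "i < j" "j \<le> b" "\<tau> j < \<tau> i"
    have "card (southwest (skew_sum a b \<sigma> \<tau>) (a + i) (a + j)) \<le> k"
      by (rule sw_boundedD [OF S]) (use ij in \<open>auto simp: skew_sum_def\<close>)
    then show "card (southwest \<tau> i j) \<le> k"
      using ij by (simp add: southwest_skew_sum_right [OF t] card_image)
  qed
next
  assume S: "sw_bounded k a \<sigma> \<and> sw_bounded k b \<tau>"
  show "sw_bounded k (a + b) (skew_sum a b \<sigma> \<tau>)"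
    unfolding sw_bounded_def
  proof (intro allI impI, elim conjE)
    fix i j assume ij: "1 \<le> i" "i < j" "j \<le> a + b" "skew_sum a b \<sigma> \<tau> j < skew_sum a b \<sigma> \<tau> i"
    consider "j \<le> a" | "i \<le> a" "a < j" | "a < i" using ij by linarith
    then show "card (southwest (skew_sum a b \<sigma> \<tau>) i j) \<le> k"
    proof cases
      case 1
      then have "\<sigma> j < \<sigma> i" using ij by (auto simp: skew_sum_def)
      then show ?thesis
        using S ij 1 by (auto simp: southwest_skew_sum_left intro: sw_boundedD)
    next
      case 2
      define j' where "j' = j - a"
      have "j = a + j'" "j' \<in> {1..b}" using 2 ij by (auto simp: j'_def)
      then show ?thesis using southwest_skew_sum_mixed [OF t \<open>i \<le> a\<close>] by simp
    next
      case 3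
      define i' j' where d: "i' = i - a" "j' = j - a"
      have e: "i = a + i'" "j = a + j'" "1 \<le> i'" "i' < j'" "j' \<le> b"
        using 3 ij by (auto simp: d)
      then have "\<tau> j' < \<tau> i'" using ij by (auto simp: skew_sum_def split: if_splits)
      then show ?thesis
        using S e by (auto simp: southwest_skew_sum_right [OF t] card_image intro: sw_boundedD)
    qed
  qed
qed

text \<open>
  When the first \<open>a\<close> positions take values above \<open>b\<close>, a count shows that they take all of them, and
  the remaining positions are left with \<open>{1..b}\<close>.
\<close>
lemma skew_sum_split:
  assumes p: "\<pi> permutes {1..a+b}" and hi: "\<And>i. i \<in> {1..a} \<Longrightarrow> b < \<pi> i"
  obtains \<sigma> \<tau> where "\<sigma> permutes {1..a}" "\<tau> permutes {1..b}" "\<pi> = skew_sum a b \<sigma> \<tau>"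
proof
  define \<sigma> where "\<sigma> = (\<lambda>i. if i \<in> {1..a} then \<pi> i - b else i)"
  define \<tau> where "\<tau> = (\<lambda>i. if i \<in> {1..b} then \<pi> (a + i) else i)"
  have inj: "inj \<pi>" using permutes_inj [OF p] .
  have up: "\<pi> ` {1..a} = {b+1..a+b}"
  proof (rule card_subset_eq)
    show "\<pi> ` {1..a} \<subseteq> {b+1..a+b}"
      using hi permutes_range [OF p] by fastforce
    show "card (\<pi> ` {1..a}) = card {b+1..a+b}"
      using card_image [OF inj_on_subset [OF inj subset_UNIV], of "{1..a}"] by simp
  qed simp
  have lo: "\<pi> i \<le> b" if "i \<in> {a+1..a+b}" for i
  proof (rule ccontr)
    assume "\<not> \<pi> i \<le> b"
    then have "\<pi> i \<in> \<pi> ` {1..a}" using up permutes_range [OF p, of i] that by auto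
    then show False using inj_image_mem_iff [OF inj] that by auto
  qed
  show "\<sigma> permutes {1..a}"
  proof (rule bij_imp_permutes)
    show "\<sigma> x = x" if "x \<notin> {1..a}" for x using that by (auto simp: \<sigma>_def)
    have "inj_on \<sigma> {1..a}"
    proof (rule inj_onI)
      fix x y assume "x \<in> {1..a}" "y \<in> {1..a}" "\<sigma> x = \<sigma> y"
      then have "\<pi> x = \<pi> y" using hi [of x] hi [of y] by (auto simp: \<sigma>_def)
      then show "x = y" using inj by (auto dest: injD)
    qed
    moreover have "\<sigma> ` {1..a} \<subseteq> {1..a}"
      using hi permutes_range [OF p] by (force simp: \<sigma>_def)
    ultimately show "bij_betw \<sigma> {1..a} {1..a}"
      by (simp add: bij_betw_def endo_inj_surj)
  qed
  show "\<tau> permutes {1..b}"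
  proof (rule bij_imp_permutes)
    show "\<tau> x = x" if "x \<notin> {1..b}" for x using that by (auto simp: \<tau>_def)
    have "inj_on \<tau> {1..b}"
      by (rule inj_onI) (auto simp: \<tau>_def inj_eq [OF inj])
    moreover have "\<tau> ` {1..b} \<subseteq> {1..b}"
    proof (rule image_subsetI)
      fix x assume "x \<in> {1..b}"
      then show "\<tau> x \<in> {1..b}"
        using lo [of "a + x"] permutes_range [OF p, of "a + x"] by (auto simp: \<tau>_def)
    qed
    ultimately show "bij_betw \<tau> {1..b} {1..b}"
      by (simp add: bij_betw_def endo_inj_surj)
  qed
  show "\<pi> = skew_sum a b \<sigma> \<tau>"
  proof
    fix i
    consider "i \<in> {1..a}" | "i \<in> {a+1..a+b}" | "i \<notin> {1..a+b}" by fastforce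
    then show "\<pi> i = skew_sum a b \<sigma> \<tau> i"
    proof cases
      case 1
      then show ?thesis using hi [of i] by (auto simp: skew_sum_def \<sigma>_def)
    next
      case 2
      then have "i - a \<in> {1..b}" by auto
      with 2 show ?thesis by (auto simp: skew_sum_def \<tau>_def)
    next
      case 3
      then show ?thesis using permutes_not_in [OF p, of i] by (auto simp: skew_sum_def)
    qed
  qed
qed

section \<open>Permutations symmetric in the antidiagonal\<close>

text \<open>
  Reflection in the antidiagonal is the composition of \<open>inv\<close> and \<open>rc m\<close>, so invariance under it is
  the equation \<open>rc m \<pi> = inv \<pi>\<close>.
\<close>
definition adiag_perms :: "nat \<Rightarrow> nat \<Rightarrow> (nat \<Rightarrow> nat) set" where
  "adiag_perms k m = {\<pi>. \<pi> permutes {1..m} \<and> rc m \<pi> = inv \<pi> \<and> sw_bounded k m \<pi>}"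

text \<open>
  For \<open>m \<ge> 1\<close> these are the possible first blocks in the decomposition into skew sums.
\<close>
definition adiag_blocks :: "nat \<Rightarrow> nat \<Rightarrow> (nat \<Rightarrow> nat) set" where
  "adiag_blocks k m = {\<pi> \<in> adiag_perms k m. \<pi> 1 = 1}"

text \<open>
  For involutions, \<open>rc m \<pi> = inv \<pi>\<close> is centrosymmetry.
\<close>
definition adiag_invols :: "nat \<Rightarrow> nat \<Rightarrow> (nat \<Rightarrow> nat) set" where
  "adiag_invols k m = {\<pi> \<in> adiag_perms k m. inv \<pi> = \<pi>}"

lemma adiag_permutes: "\<pi> \<in> adiag_perms k m \<Longrightarrow> \<pi> permutes {1..m}"
  by (simp add: adiag_perms_def)

lemma finite_adiag_perms [simp]: "finite (adiag_perms k m)"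
  by (rule finite_subset [OF _ finite_permutations [of "{1..m}"]]) (auto simp: adiag_perms_def)

lemma rc_outside: "i \<notin> {1..m} \<Longrightarrow> rc m \<pi> i = i"
  by (auto simp: rc_def)

lemma rc_involution:
  assumes p: "\<pi> permutes {1..m}"
  shows "rc m (rc m \<pi>) = \<pi>"
proof
  fix i
  show "rc m (rc m \<pi>) i = \<pi> i"
  proof (cases "i \<in> {1..m}")
    case True
    then have "m + 1 - (m + 1 - i) = i" "m + 1 - i \<in> {1..m}" by auto
    then show ?thesis using True permutes_range [OF p, of i] by (auto simp: rc_def)
  next
    case False
    then show ?thesis using permutes_not_in [OF p] by (auto simp: rc_def)
  qed
qed

lemma adiag_inv:
  assumes "\<pi> \<in> adiag_perms k m"
  shows "inv \<pi> \<in> adiag_perms k m"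
proof -
  have p: "\<pi> permutes {1..m}" and r: "rc m \<pi> = inv \<pi>"
    using assms by (auto simp: adiag_perms_def)
  have "rc m (inv \<pi>) = \<pi>" using rc_involution [OF p] r by simp
  then show ?thesis
    using assms by (simp add: adiag_perms_def permutes_inv sw_bounded_inv permutes_inv_inv [OF p])
qed

text \<open>
  Both \<open>inv\<close> and \<open>rc\<close> exchange the two summands, so the equation \<open>rc m \<pi> = inv \<pi>\<close> splits.
\<close>
lemma skew_sum_adiag_iff:
  assumes s: "\<sigma> permutes {1..a}" and t: "\<tau> permutes {1..b}"
  shows "skew_sum a b \<sigma> \<tau> \<in> adiag_perms k (a + b) \<longleftrightarrow>
    \<sigma> \<in> adiag_perms k a \<and> \<tau> \<in> adiag_perms k b"
proof -
  have "skew_sum b a (rc b \<tau>) (rc a \<sigma>) = skew_sum b a (inv \<tau>) (inv \<sigma>) \<longleftrightarrow>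
      rc b \<tau> = inv \<tau> \<and> rc a \<sigma> = inv \<sigma>"
  proof
    assume eq: "skew_sum b a (rc b \<tau>) (rc a \<sigma>) = skew_sum b a (inv \<tau>) (inv \<sigma>)"
    show "rc b \<tau> = inv \<tau> \<and> rc a \<sigma> = inv \<sigma>"
      by (rule skew_sum_inject [OF eq])
         (simp_all only: rc_outside permutes_not_in [OF permutes_inv [OF s]]
           permutes_not_in [OF permutes_inv [OF t]] not_False_eq_True)
  qed simp
  then show ?thesis
    using s t skew_sum_permutes [OF s t] rc_skew_sum [OF s t] inv_skew_sum [OF s t]
      sw_bounded_skew_sum [OF t]
    by (auto simp: adiag_perms_def)
qed

text \<open>
  The first point \<open>(1, m + 1 - a)\<close> is reflected to \<open>(a, m)\<close>.
\<close>
lemma adiag_last: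
  assumes "\<pi> \<in> adiag_perms k m" "1 \<le> m" "\<pi> 1 = m + 1 - a" "1 \<le> a" "a \<le> m"
  shows "\<pi> a = m"
proof -
  have p: "\<pi> permutes {1..m}" and "rc m \<pi> = inv \<pi>"
    using assms by (auto simp: adiag_perms_def)
  then have "inv \<pi> m = rc m \<pi> m" by simp
  also have "\<dots> = a" using assms by (simp add: rc_def)
  finally show ?thesis using permutes_inverses [OF p] by metis
qed

section \<open>Splitting off the first block\<close>

text \<open>
  Suppose a position \<open>i < a\<close> had a low value. Then some position \<open>j\<close> beyond \<open>a\<close> has a high value, and
  the points of positions \<open>1\<close> and \<open>i\<close> both lie south-west of the inversion formed by the maximum, at
  position \<open>a\<close>, and the point at \<open>j\<close>. This is the step that needs \<open>k \<le> 1\<close>.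
\<close>
lemma first_block_high:
  assumes X: "\<pi> \<in> adiag_perms k (a + b)" and k: "k \<le> 1" and a: "1 \<le> a"
    and first: "\<pi> 1 = b + 1" and i: "i \<in> {1..a}"
  shows "b < \<pi> i"
proof (rule ccontr)
  assume low: "\<not> b < \<pi> i"
  have p: "\<pi> permutes {1..a+b}" using X by (rule adiag_permutes)
  have inj: "inj \<pi>" using permutes_inj [OF p] .
  have last: "\<pi> a = a + b" using adiag_last [OF X _ _ a] a first by simp
  have ne: "i \<noteq> 1" "i \<noteq> a" using low first last a by auto
  \<comment> \<open>Otherwise all \<open>a\<close> high values would sit in the \<open>a - 1\<close> positions up to \<open>a\<close> other than \<open>i\<close>.\<close>
  have "\<exists>j>a. j \<le> a + b \<and> b < \<pi> j"
  proof (rule ccontr)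
    assume "\<not> (\<exists>j>a. j \<le> a + b \<and> b < \<pi> j)"
    then have small: "j \<le> a" if "j \<le> a + b" "b < \<pi> j" for j using that not_le by blast
    have "inv \<pi> ` {b+1..a+b} \<subseteq> {1..a} - {i}"
    proof (rule image_subsetI)
      fix v assume v: "v \<in> {b+1..a+b}"
      have "\<pi> (inv \<pi> v) = v" using permutes_inverses [OF p] by auto
      moreover have "1 \<le> inv \<pi> v \<and> inv \<pi> v \<le> a + b" using permutes_range [OF permutes_inv [OF p], of v] v by auto
      ultimately show "inv \<pi> v \<in> {1..a} - {i}"
        using small [of "inv \<pi> v"] v low by auto
    qed
    then have "card (inv \<pi> ` {b+1..a+b}) \<le> card ({1..a} - {i})"
      by (intro card_mono) auto
    moreover have "card (inv \<pi> ` {b+1..a+b}) = a"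
      using card_image [OF inj_on_subset [OF permutes_inj [OF permutes_inv [OF p]] subset_UNIV]]
      by simp
    moreover have "card ({1..a} - {i}) = a - 1" using i by simp
    ultimately show False using a by simp
  qed
  then obtain j where j: "a < j" "j \<le> a + b" "b < \<pi> j" by blast
  have "\<pi> j \<noteq> \<pi> 1" "\<pi> j \<noteq> \<pi> a" using j a injD [OF inj] by fastforce+
  then have w: "b + 1 < \<pi> j" "\<pi> j < a + b"
    using j first last permutes_range [OF p, of j] by auto
  have "card (southwest \<pi> a j) \<le> k"
    by (rule sw_boundedD [of k "a + b"]) (use X a j w last in \<open>auto simp: adiag_perms_def\<close>)
  moreover have "{1, i} \<subseteq> southwest \<pi> a j"
    using i ne low w first by (auto simp: southwest_def)
  then have "card {1, i} \<le> card (southwest \<pi> a j)" by (intro card_mono) auto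
  ultimately show False using ne k by simp
qed

lemma skew_sum_inject_permutes:
  assumes "skew_sum a b \<sigma> \<tau> = skew_sum a b \<sigma>' \<tau>'"
    and "\<sigma> permutes {1..a}" "\<sigma>' permutes {1..a}" "\<tau> permutes {1..b}" "\<tau>' permutes {1..b}"
  shows "\<sigma> = \<sigma>' \<and> \<tau> = \<tau>'"
  by (rule skew_sum_inject [OF assms(1)])
     (simp_all only: permutes_not_in [OF assms(2)] permutes_not_in [OF assms(3)]
       permutes_not_in [OF assms(4)] permutes_not_in [OF assms(5)] not_False_eq_True)

lemma skew_sum_first: "1 \<le> a \<Longrightarrow> skew_sum a b \<sigma> \<tau> 1 = b + \<sigma> 1"
  by (simp add: skew_sum_def)

lemma adiag_decompose:
  assumes X: "\<pi> \<in> adiag_perms k (a + b)" and k: "k \<le> 1" and a: "1 \<le> a"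
    and first: "\<pi> 1 = b + 1"
  obtains \<sigma> \<tau> where "\<sigma> \<in> adiag_blocks k a" "\<tau> \<in> adiag_perms k b" "\<pi> = skew_sum a b \<sigma> \<tau>"
proof -
  obtain \<sigma> \<tau> where st: "\<sigma> permutes {1..a}" "\<tau> permutes {1..b}" "\<pi> = skew_sum a b \<sigma> \<tau>"
    using skew_sum_split [OF adiag_permutes [OF X] first_block_high [OF X k a first]] by metis
  have "\<sigma> \<in> adiag_perms k a" "\<tau> \<in> adiag_perms k b"
    using skew_sum_adiag_iff [OF st(1,2)] X st(3) by auto
  moreover have "\<sigma> 1 = 1" using first a by (simp add: st(3) skew_sum_first)
  ultimately show ?thesis using that st(3) by (simp add: adiag_blocks_def)
qed

lemma card_adiag_perms_first:
  assumes k: "k \<le> 1" and a: "1 \<le> a"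
  shows "card {\<pi> \<in> adiag_perms k (a + b). \<pi> 1 = b + 1} =
    card (adiag_blocks k a) * card (adiag_perms k b)"
proof -
  have "bij_betw (\<lambda>(\<sigma>, \<tau>). skew_sum a b \<sigma> \<tau>) (adiag_blocks k a \<times> adiag_perms k b)
      {\<pi> \<in> adiag_perms k (a + b). \<pi> 1 = b + 1}"
  proof (rule bij_betw_imageI)
    show "inj_on (\<lambda>(\<sigma>, \<tau>). skew_sum a b \<sigma> \<tau>) (adiag_blocks k a \<times> adiag_perms k b)"
    proof (rule inj_onI, clarify)
      fix \<sigma> \<tau> \<sigma>' \<tau>'
      assume "\<sigma> \<in> adiag_blocks k a" "\<sigma>' \<in> adiag_blocks k a"
        and "\<tau> \<in> adiag_perms k b" "\<tau>' \<in> adiag_perms k b"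
        and eq: "skew_sum a b \<sigma> \<tau> = skew_sum a b \<sigma>' \<tau>'"
      then show "\<sigma> = \<sigma>' \<and> \<tau> = \<tau>'"
        by (intro skew_sum_inject_permutes [OF eq]) (simp_all add: adiag_blocks_def adiag_perms_def)
    qed
    show "(\<lambda>(\<sigma>, \<tau>). skew_sum a b \<sigma> \<tau>) ` (adiag_blocks k a \<times> adiag_perms k b) =
        {\<pi> \<in> adiag_perms k (a + b). \<pi> 1 = b + 1}" (is "?L = ?R")
    proof
      show "?L \<subseteq> ?R"
        using a by (auto simp: adiag_blocks_def skew_sum_adiag_iff adiag_permutes skew_sum_first)
      show "?R \<subseteq> ?L"
      proof
        fix \<pi> assume "\<pi> \<in> ?R"
        then have "\<pi> \<in> adiag_perms k (a + b)" "\<pi> 1 = b + 1" by auto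
        from adiag_decompose [OF this(1) k a this(2)] obtain \<sigma> \<tau>
          where "\<sigma> \<in> adiag_blocks k a" "\<tau> \<in> adiag_perms k b" "\<pi> = skew_sum a b \<sigma> \<tau>" .
        then show "\<pi> \<in> ?L" by (intro image_eqI [of _ _ "(\<sigma>, \<tau>)"]) auto
      qed
    qed
  qed
  from bij_betw_same_card [OF this] show ?thesis by (simp only: card_cartesian_product)
qed

lemma inv_skew_sum3:
  assumes s: "\<sigma> permutes {1..a}" and t: "\<tau> permutes {1..b}" and u: "\<upsilon> permutes {1..a}"
  shows "inv (skew_sum a (b + a) \<sigma> (skew_sum b a \<tau> \<upsilon>)) =
    skew_sum a (b + a) (inv \<upsilon>) (skew_sum b a (inv \<tau>) (inv \<sigma>))"
proof -
  have "inv (skew_sum a (b + a) \<sigma> (skew_sum b a \<tau> \<upsilon>)) =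
      skew_sum (b + a) a (inv (skew_sum b a \<tau> \<upsilon>)) (inv \<sigma>)"
    by (rule inv_skew_sum [OF s skew_sum_permutes [OF t u]])
  also have "\<dots> = skew_sum (a + b) a (skew_sum a b (inv \<upsilon>) (inv \<tau>)) (inv \<sigma>)"
    by (simp only: inv_skew_sum [OF t u] add.commute)
  also have "\<dots> = skew_sum a (b + a) (inv \<upsilon>) (skew_sum b a (inv \<tau>) (inv \<sigma>))"
    by (rule skew_sum_assoc)
  finally show ?thesis .
qed

text \<open>
  After the first block \<open>\<sigma>\<close> is split off, the remaining summand \<open>\<rho>\<close> must end in a block of size \<open>a\<close>,
  because the involution sends the last \<open>a\<close> positions to the first \<open>a\<close> values. Comparing the three
  blocks with those of the inverse identifies the last block as \<open>inv \<sigma>\<close>.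
\<close>
lemma invol_decompose:
  assumes I: "\<pi> \<in> adiag_invols k (a + (b + a))" and k: "k \<le> 1" and a: "1 \<le> a"
    and first: "\<pi> 1 = b + a + 1"
  obtains \<sigma> \<tau> where "\<sigma> \<in> adiag_blocks k a" "\<tau> \<in> adiag_invols k b"
    "\<pi> = skew_sum a (b + a) \<sigma> (skew_sum b a \<tau> (inv \<sigma>))"
proof -
  have X: "\<pi> \<in> adiag_perms k (a + (b + a))" and inv: "inv \<pi> = \<pi>"
    using I by (auto simp: adiag_invols_def)
  have p: "\<pi> permutes {1..a + (b + a)}" using X by (rule adiag_permutes)
  obtain \<sigma> \<rho> where sr: "\<sigma> \<in> adiag_blocks k a" "\<rho> \<in> adiag_perms k (b + a)"
      "\<pi> = skew_sum a (b + a) \<sigma> \<rho>"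
    by (rule adiag_decompose [OF X k a first])
  have s: "\<sigma> permutes {1..a}" using sr by (auto simp: adiag_blocks_def adiag_permutes)
  have r: "\<rho> permutes {1..b + a}" using sr by (auto simp: adiag_permutes)
  \<comment> \<open>A value of \<open>\<rho>\<close> up to \<open>a\<close> is a position of the first block, whose image is above
    \<open>b + a\<close>, while the involution sends it to \<open>a + i\<close>.\<close>
  have high: "a < \<rho> i" if i: "i \<in> {1..b}" for i
  proof (rule ccontr)
    assume low: "\<not> a < \<rho> i"
    have "1 \<le> \<rho> i" using permutes_range [OF r, of i] i by auto
    have "\<rho> i = \<pi> (a + i)" using i by (auto simp: sr(3) skew_sum_def)
    then have "\<pi> (\<rho> i) = a + i" using permutes_inverses(2) [OF p, of "a + i"] inv by simp
    moreover have "\<pi> (\<rho> i) = b + a + \<sigma> (\<rho> i)" using low \<open>1 \<le> \<rho> i\<close> by (simp add: sr(3) skew_sum_def)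
    moreover have "1 \<le> \<sigma> (\<rho> i)" using permutes_range [OF s, of "\<rho> i"] low \<open>1 \<le> \<rho> i\<close> by simp
    ultimately show False using i by auto
  qed
  obtain \<tau> \<upsilon> where tu: "\<tau> permutes {1..b}" "\<upsilon> permutes {1..a}" "\<rho> = skew_sum b a \<tau> \<upsilon>"
    using skew_sum_split [OF r high] by metis
  have "skew_sum a (b + a) \<sigma> (skew_sum b a \<tau> \<upsilon>) =
      skew_sum a (b + a) (inv \<upsilon>) (skew_sum b a (inv \<tau>) (inv \<sigma>))"
    using inv_skew_sum3 [OF s tu(1,2)] inv by (simp add: sr(3) tu(3))
  from skew_sum_inject_permutes [OF this s permutes_inv [OF tu(2)] skew_sum_permutes [OF tu(1,2)]
      skew_sum_permutes [OF permutes_inv [OF tu(1)] permutes_inv [OF s]]]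
  have "skew_sum b a \<tau> \<upsilon> = skew_sum b a (inv \<tau>) (inv \<sigma>)" by simp
  from skew_sum_inject_permutes [OF this tu(1) permutes_inv [OF tu(1)] tu(2) permutes_inv [OF s]]
  have eqs: "\<tau> = inv \<tau>" "\<upsilon> = inv \<sigma>" by auto
  have "\<tau> \<in> adiag_perms k b"
    using skew_sum_adiag_iff [OF tu(1,2)] sr(2) tu(3) by simp
  then have "\<tau> \<in> adiag_invols k b" using eqs(1) by (simp add: adiag_invols_def)
  with sr(1) show ?thesis by (rule that) (simp only: sr(3) tu(3) eqs(2))
qed

lemma card_adiag_invols_first:
  assumes k: "k \<le> 1" and a: "1 \<le> a"
  shows "card {\<pi> \<in> adiag_invols k (a + (b + a)). \<pi> 1 = b + a + 1} =
    card (adiag_blocks k a) * card (adiag_invols k b)"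
proof -
  let ?f = "\<lambda>(\<sigma>, \<tau>). skew_sum a (b + a) \<sigma> (skew_sum b a \<tau> (inv \<sigma>))"
  have perms: "\<sigma> permutes {1..a} \<and> inv \<sigma> permutes {1..a} \<and> \<tau> permutes {1..b} \<and>
      skew_sum b a \<tau> (inv \<sigma>) permutes {1..b + a}"
    if "\<sigma> \<in> adiag_blocks k a" "\<tau> \<in> adiag_invols k b" for \<sigma> \<tau>
  proof -
    have s: "\<sigma> permutes {1..a}" and t: "\<tau> permutes {1..b}"
      using that by (simp_all add: adiag_blocks_def adiag_invols_def adiag_perms_def)
    show ?thesis
      using s t permutes_inv [OF s] skew_sum_permutes [OF t permutes_inv [OF s]] by (intro conjI)
  qed
  have "bij_betw ?f (adiag_blocks k a \<times> adiag_invols k b)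
      {\<pi> \<in> adiag_invols k (a + (b + a)). \<pi> 1 = b + a + 1}"
  proof (rule bij_betw_imageI)
    show "inj_on ?f (adiag_blocks k a \<times> adiag_invols k b)"
    proof (rule inj_onI, clarify)
      fix \<sigma> \<tau> \<sigma>' \<tau>'
      assume st: "\<sigma> \<in> adiag_blocks k a" "\<tau> \<in> adiag_invols k b"
        and st': "\<sigma>' \<in> adiag_blocks k a" "\<tau>' \<in> adiag_invols k b"
        and eq: "skew_sum a (b + a) \<sigma> (skew_sum b a \<tau> (inv \<sigma>)) =
          skew_sum a (b + a) \<sigma>' (skew_sum b a \<tau>' (inv \<sigma>'))"
      note P = perms [OF st] perms [OF st']
      have eqs: "\<sigma> = \<sigma>' \<and> skew_sum b a \<tau> (inv \<sigma>) = skew_sum b a \<tau>' (inv \<sigma>')"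
        by (rule skew_sum_inject_permutes [OF eq]) (use P in simp_all)
      have "\<tau> = \<tau>' \<and> inv \<sigma> = inv \<sigma>'"
        by (rule skew_sum_inject_permutes [OF conjunct2 [OF eqs]]) (use P in simp_all)
      then show "\<sigma> = \<sigma>' \<and> \<tau> = \<tau>'" using eqs by blast
    qed
    show "?f ` (adiag_blocks k a \<times> adiag_invols k b) =
        {\<pi> \<in> adiag_invols k (a + (b + a)). \<pi> 1 = b + a + 1}" (is "?L = ?R")
    proof
      show "?L \<subseteq> ?R"
      proof clarify
        fix \<sigma> \<tau> assume st: "\<sigma> \<in> adiag_blocks k a" "\<tau> \<in> adiag_invols k b"
        have s: "\<sigma> \<in> adiag_perms k a" "\<sigma> 1 = 1" and t: "\<tau> \<in> adiag_perms k b" "inv \<tau> = \<tau>"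
          using st by (auto simp: adiag_blocks_def adiag_invols_def)
        have P: "\<sigma> permutes {1..a}" "inv \<sigma> permutes {1..a}" "\<tau> permutes {1..b}"
          "skew_sum b a \<tau> (inv \<sigma>) permutes {1..b + a}"
          using perms [OF st] by auto
        have "skew_sum a (b + a) \<sigma> (skew_sum b a \<tau> (inv \<sigma>)) \<in> adiag_perms k (a + (b + a))"
          using s(1) t(1) adiag_inv [OF s(1)] P by (simp add: skew_sum_adiag_iff)
        moreover have "inv (skew_sum a (b + a) \<sigma> (skew_sum b a \<tau> (inv \<sigma>))) =
            skew_sum a (b + a) \<sigma> (skew_sum b a \<tau> (inv \<sigma>))"
          using inv_skew_sum3 [OF P(1,3,2)] t(2) by (simp add: permutes_inv_inv [OF P(1)])
        moreover have "skew_sum a (b + a) \<sigma> (skew_sum b a \<tau> (inv \<sigma>)) 1 = b + a + 1"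
          using skew_sum_first [OF a] s(2) by simp
        ultimately show "skew_sum a (b + a) \<sigma> (skew_sum b a \<tau> (inv \<sigma>)) \<in>
            adiag_invols k (a + (b + a)) \<and>
            skew_sum a (b + a) \<sigma> (skew_sum b a \<tau> (inv \<sigma>)) 1 = b + a + 1"
          by (simp add: adiag_invols_def)
      qed
      show "?R \<subseteq> ?L"
      proof
        fix \<pi> assume "\<pi> \<in> ?R"
        then have "\<pi> \<in> adiag_invols k (a + (b + a))" "\<pi> 1 = b + a + 1" by auto
        from invol_decompose [OF this(1) k a this(2)] obtain \<sigma> \<tau>
          where "\<sigma> \<in> adiag_blocks k a" "\<tau> \<in> adiag_invols k b"
            "\<pi> = skew_sum a (b + a) \<sigma> (skew_sum b a \<tau> (inv \<sigma>))" .
        then show "\<pi> \<in> ?L" by (intro image_eqI [of _ _ "(\<sigma>, \<tau>)"]) auto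
      qed
    qed
  qed
  from bij_betw_same_card [OF this] show ?thesis by (simp only: card_cartesian_product)
qed

text \<open>
  The value 1 is taken at position \<open>b + 1\<close>, which cannot lie in the first block: there all values
  exceed \<open>b \<ge> 1\<close>. So the block and its mirror image do not overlap.
\<close>
lemma invol_first_block_fits:
  assumes I: "\<pi> \<in> adiag_invols k (a + b)" and k: "k \<le> 1" and a: "1 \<le> a" and b: "1 \<le> b"
    and first: "\<pi> 1 = b + 1"
  shows "a \<le> b"
proof (rule ccontr)
  assume "\<not> a \<le> b"
  have X: "\<pi> \<in> adiag_perms k (a + b)" and inv: "inv \<pi> = \<pi>"
    using I by (auto simp: adiag_invols_def)
  have "\<pi> (b + 1) = 1"
    using permutes_inverses(2) [OF adiag_permutes [OF X], of 1] inv first by simp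
  moreover have "b < \<pi> (b + 1)"
    by (rule first_block_high [OF X k a first]) (use \<open>\<not> a \<le> b\<close> in auto)
  ultimately show False using b by simp
qed

lemma card_adiag_perms_rec:
  assumes k: "k \<le> 1" and m: "1 \<le> m"
  shows "card (adiag_perms k m) =
    (\<Sum>a = 1..m. card (adiag_blocks k a) * card (adiag_perms k (m - a)))"
proof -
  let ?C = "\<lambda>a. {\<pi> \<in> adiag_perms k m. \<pi> 1 = m - a + 1}"
  have "adiag_perms k m = (\<Union>a \<in> {1..m}. ?C a)"
  proof (intro set_eqI iffI)
    fix \<pi> assume X: "\<pi> \<in> adiag_perms k m"
    have "1 \<le> \<pi> 1 \<and> \<pi> 1 \<le> m" using permutes_range [OF adiag_permutes [OF X]] m by auto
    then have "m + 1 - \<pi> 1 \<in> {1..m}" "\<pi> 1 = m - (m + 1 - \<pi> 1) + 1" by auto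
    then show "\<pi> \<in> (\<Union>a \<in> {1..m}. ?C a)" using X by blast
  qed blast
  then have "card (adiag_perms k m) = card (\<Union>a \<in> {1..m}. ?C a)" by simp
  also have "\<dots> = (\<Sum>a = 1..m. card (?C a))"
    by (rule card_UN_disjoint) auto
  also have "\<dots> = (\<Sum>a = 1..m. card (adiag_blocks k a) * card (adiag_perms k (m - a)))"
  proof (rule sum.cong)
    fix a assume "a \<in> {1..m}"
    then show "card (?C a) = card (adiag_blocks k a) * card (adiag_perms k (m - a))"
      using card_adiag_perms_first [OF k, of a "m - a"] by simp
  qed simp
  finally show ?thesis .
qed

lemma card_adiag_invols_rec:
  assumes k: "k \<le> 1" and m: "1 \<le> m"
  shows "card (adiag_invols k m) = card {\<pi> \<in> adiag_invols k m. \<pi> 1 = 1} +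
    (\<Sum>a = 1..m div 2. card (adiag_blocks k a) * card (adiag_invols k (m - 2 * a)))"
proof -
  let ?C = "\<lambda>a. {\<pi> \<in> adiag_invols k m. \<pi> 1 = m - a + 1}"
  let ?F = "{\<pi> \<in> adiag_invols k m. \<pi> 1 = 1}"
  have fin: "finite (adiag_invols k m)"
    by (rule finite_subset [OF _ finite_adiag_perms]) (auto simp: adiag_invols_def)
  have "adiag_invols k m = ?F \<union> (\<Union>a \<in> {1..m div 2}. ?C a)"
  proof (intro set_eqI iffI)
    fix \<pi> assume I: "\<pi> \<in> adiag_invols k m"
    then have X: "\<pi> \<in> adiag_perms k m" by (simp add: adiag_invols_def)
    have "1 \<le> \<pi> 1 \<and> \<pi> 1 \<le> m" using permutes_range [OF adiag_permutes [OF X]] m by auto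
    then have "m = (m + 1 - \<pi> 1) + (\<pi> 1 - 1)" "\<pi> 1 = \<pi> 1 - 1 + 1" "1 \<le> m + 1 - \<pi> 1" by auto
    then obtain a b where ab: "m = a + b" "\<pi> 1 = b + 1" "1 \<le> a" by blast
    show "\<pi> \<in> ?F \<union> (\<Union>a \<in> {1..m div 2}. ?C a)"
    proof (cases "b = 0")
      case False
      then have "a \<le> b" using invol_first_block_fits [of \<pi> k a b] I k ab by auto
      then have "a \<in> {1..m div 2}" using ab by auto
      moreover have "\<pi> \<in> ?C a" using I ab by simp
      ultimately show ?thesis by blast
    qed (use I ab in auto)
  qed blast
  then have "card (adiag_invols k m) = card (?F \<union> (\<Union>a \<in> {1..m div 2}. ?C a))" by simp
  also have "\<dots> = card ?F + card (\<Union>a \<in> {1..m div 2}. ?C a)"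
    by (rule card_Un_disjoint) (use fin in auto)
  also have "card (\<Union>a \<in> {1..m div 2}. ?C a) = (\<Sum>a = 1..m div 2. card (?C a))"
    by (rule card_UN_disjoint) (use fin in auto)
  also have "\<dots> = (\<Sum>a = 1..m div 2. card (adiag_blocks k a) * card (adiag_invols k (m - 2 * a)))"
  proof (rule sum.cong)
    fix a assume a: "a \<in> {1..m div 2}"
    then have sizes: "m - 2 * a + a = m - a" "a + (m - a) = m" by auto
    have "1 \<le> a" using a by simp
    from card_adiag_invols_first [OF k this, of "m - 2 * a"]
    show "card (?C a) = card (adiag_blocks k a) * card (adiag_invols k (m - 2 * a))"
      by (simp only: sizes)
  qed simp
  finally show ?thesis .
qed

section \<open>Adding a first and a last fixed point\<close>

text \<open>
  Shifts \<open>\<rho>\<close> by one in both directions; the points \<open>(1, 1)\<close> and \<open>(m + 2, m + 2)\<close> that frame it come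
  from the default case.
\<close>
definition frame :: "nat \<Rightarrow> (nat \<Rightarrow> nat) \<Rightarrow> nat \<Rightarrow> nat" where
  "frame m \<rho> = (\<lambda>i. if i \<in> {2..m+1} then \<rho> (i - 1) + 1 else i)"

lemma frame_inverse:
  assumes r: "\<rho> permutes {1..m}"
  shows "frame m (inv \<rho>) (frame m \<rho> i) = i"
proof (cases "i \<in> {2..m+1}")
  case True
  then have "1 \<le> \<rho> (i - 1)" "\<rho> (i - 1) \<le> m" using permutes_range [OF r, of "i - 1"] by auto
  then show ?thesis using True permutes_inverses [OF r] by (simp add: frame_def)
qed (auto simp: frame_def)

lemma inv_frame: "\<rho> permutes {1..m} \<Longrightarrow> inv (frame m \<rho>) = frame m (inv \<rho>)"
  using frame_inverse [of \<rho> m] frame_inverse [of "inv \<rho>" m]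
  by (intro inv_of_inverse_pair) (simp_all add: permutes_inv permutes_inv_inv)

lemma frame_permutes:
  assumes r: "\<rho> permutes {1..m}"
  shows "frame m \<rho> permutes {1..m+2}"
proof -
  have "bij (frame m \<rho>)"
    using frame_inverse [OF r] frame_inverse [OF permutes_inv [OF r]]
    by (intro o_bij [of "frame m (inv \<rho>)"]) (auto simp: fun_eq_iff permutes_inv_inv [OF r])
  then show ?thesis by (auto simp: permutes_def bij_iff frame_def)
qed

lemma frame_inject:
  assumes eq: "frame m \<rho> = frame m \<rho>'"
    and out: "\<And>i. i \<notin> {1..m} \<Longrightarrow> \<rho> i = i" "\<And>i. i \<notin> {1..m} \<Longrightarrow> \<rho>' i = i"
  shows "\<rho> = \<rho>'"
proof
  fix i show "\<rho> i = \<rho>' i"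
    using fun_cong [OF eq, of "i + 1"] out [of i]
    by (cases "i \<in> {1..m}") (auto simp: frame_def)
qed

lemma rc_frame:
  assumes r: "\<rho> permutes {1..m}"
  shows "rc (m + 2) (frame m \<rho>) = frame m (rc m \<rho>)"
proof
  fix i
  consider "i \<in> {2..m+1}" | "i = 1 \<or> i = m + 2" | "i \<notin> {1..m+2}" by fastforce
  then show "rc (m + 2) (frame m \<rho>) i = frame m (rc m \<rho>) i"
  proof cases
    case 1
    define j where "j = m + 1 - (i - 1)"
    have j: "j \<in> {1..m}" "m + 2 + 1 - i = j + 1" and i: "i - 1 \<in> {1..m}"
      using 1 by (auto simp: j_def)
    have "rc (m + 2) (frame m \<rho>) i = m + 2 + 1 - frame m \<rho> (j + 1)"
      using 1 j by (simp add: rc_def)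
    also have "\<dots> = m + 1 - \<rho> j + 1"
      using j permutes_range [OF r, of j] by (simp add: frame_def)
    also have "\<dots> = frame m (rc m \<rho>) i"
      using 1 i by (simp add: frame_def rc_def j_def del: atLeastAtMost_iff)
    finally show ?thesis .
  qed (auto simp: frame_def rc_def)
qed

text \<open>
  The new point \<open>(1, 1)\<close> lies south-west of every inversion, and neither new point belongs to an
  inversion. So framing raises the bound by exactly one.
\<close>
lemma southwest_frame:
  assumes i: "i \<in> {1..m}" and j: "j \<in> {1..m}" and r: "\<rho> permutes {1..m}"
  shows "southwest (frame m \<rho>) (i + 1) (j + 1) = insert 1 ((\<lambda>x. x + 1) ` southwest \<rho> i j)"
proof (intro set_eqI iffI)
  fix x assume x: "x \<in> southwest (frame m \<rho>) (i + 1) (j + 1)"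
  show "x \<in> insert 1 ((\<lambda>x. x + 1) ` southwest \<rho> i j)"
  proof (cases "x = 1")
    case False
    then have "x - 1 \<in> southwest \<rho> i j" "x = x - 1 + 1"
      using x i j by (auto simp: southwest_def frame_def split: if_splits)
    then show ?thesis by blast
  qed simp
qed (use i j permutes_range [OF r, of j] in \<open>auto simp: southwest_def frame_def\<close>)

lemma card_southwest_frame:
  assumes "i \<in> {1..m}" "j \<in> {1..m}" "\<rho> permutes {1..m}"
  shows "card (southwest (frame m \<rho>) (i + 1) (j + 1)) = card (southwest \<rho> i j) + 1"
proof -
  have "1 \<notin> (\<lambda>x. x + 1) ` southwest \<rho> i j" by (auto simp: southwest_def)
  then show ?thesis
    by (simp add: southwest_frame [OF assms] card_image inj_on_def)
qed

lemma sw_bounded_frame: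
  assumes r: "\<rho> permutes {1..m}"
  shows "sw_bounded (k + 1) (m + 2) (frame m \<rho>) \<longleftrightarrow> sw_bounded k m \<rho>"
proof
  assume S: "sw_bounded (k + 1) (m + 2) (frame m \<rho>)"
  show "sw_bounded k m \<rho>"
    unfolding sw_bounded_def
  proof (intro allI impI, elim conjE)
    fix i j assume ij: "1 \<le> i" "i < j" "j \<le> m" "\<rho> j < \<rho> i"
    have "card (southwest (frame m \<rho>) (i + 1) (j + 1)) \<le> k + 1"
      by (rule sw_boundedD [OF S]) (use ij in \<open>auto simp: frame_def\<close>)
    then show "card (southwest \<rho> i j) \<le> k"
      using ij card_southwest_frame [of i m j \<rho>] r by simp
  qed
next
  assume S: "sw_bounded k m \<rho>"
  show "sw_bounded (k + 1) (m + 2) (frame m \<rho>)"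
    unfolding sw_bounded_def
  proof (intro allI impI, elim conjE)
    fix i j assume ij: "1 \<le> i" "i < j" "j \<le> m + 2" "frame m \<rho> j < frame m \<rho> i"
    define i' j' where d: "i' = i - 1" "j' = j - 1"
    have "i \<noteq> 1"
      using ij by (auto simp: frame_def split: if_splits)
    moreover have "j \<noteq> m + 2"
    proof
      assume "j = m + 2"
      with ij \<open>i \<noteq> 1\<close> show False
        using permutes_range [OF r, of "i - 1"] by (fastforce simp: frame_def)
    qed
    ultimately have e: "i = i' + 1" "j = j' + 1" "1 \<le> i'" "i' < j'" "j' \<le> m"
      using ij by (auto simp: d)
    then have "\<rho> j' < \<rho> i'" using ij by (auto simp: frame_def)
    then have "card (southwest \<rho> i' j') \<le> k" using e by (intro sw_boundedD [OF S])
    then show "card (southwest (frame m \<rho>) i j) \<le> k + 1"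
      using e card_southwest_frame [of i' m j' \<rho>] r by simp
  qed
qed

lemma frame_adiag_iff:
  assumes r: "\<rho> permutes {1..m}"
  shows "frame m \<rho> \<in> adiag_perms (k + 1) (m + 2) \<longleftrightarrow> \<rho> \<in> adiag_perms k m"
proof -
  have "frame m (rc m \<rho>) = frame m (inv \<rho>) \<longleftrightarrow> rc m \<rho> = inv \<rho>"
  proof
    assume eq: "frame m (rc m \<rho>) = frame m (inv \<rho>)"
    show "rc m \<rho> = inv \<rho>"
      by (rule frame_inject [OF eq])
         (simp_all only: rc_outside permutes_not_in [OF permutes_inv [OF r]] not_False_eq_True)
  qed simp
  then show ?thesis
    using r frame_permutes [OF r]
    by (simp add: adiag_perms_def rc_frame [OF r] inv_frame [OF r] sw_bounded_frame [OF r])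
qed

text \<open>
  A permutation symmetric in the antidiagonal that fixes the first point also fixes the last one.
\<close>
lemma frame_split:
  assumes F: "\<sigma> \<in> adiag_blocks k (m + 2)"
  obtains \<rho> where "\<rho> permutes {1..m}" "\<sigma> = frame m \<rho>"
proof
  have X: "\<sigma> \<in> adiag_perms k (m + 2)" and first: "\<sigma> 1 = 1"
    using F by (auto simp: adiag_blocks_def)
  have p: "\<sigma> permutes {1..m+2}" using X by (rule adiag_permutes)
  have inj: "inj \<sigma>" using permutes_inj [OF p] .
  have last: "\<sigma> (m + 2) = m + 2" using adiag_last [OF X, of "m + 2"] first by simp
  define \<rho> where "\<rho> = (\<lambda>i. if i \<in> {1..m} then \<sigma> (i + 1) - 1 else i)"
  have inner: "2 \<le> \<sigma> (i + 1) \<and> \<sigma> (i + 1) \<le> m + 1" if "i \<in> {1..m}" for i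
  proof -
    have "\<sigma> (i + 1) \<noteq> \<sigma> 1" "\<sigma> (i + 1) \<noteq> \<sigma> (m + 2)"
      using that by (simp_all only: inj_eq [OF inj]) auto
    then show ?thesis using permutes_range [OF p, of "i + 1"] that first last by auto
  qed
  show "\<rho> permutes {1..m}"
  proof (rule bij_imp_permutes)
    show "\<rho> x = x" if "x \<notin> {1..m}" for x using that by (auto simp: \<rho>_def)
    have "inj_on \<rho> {1..m}"
    proof (rule inj_onI)
      fix x y assume "x \<in> {1..m}" "y \<in> {1..m}" "\<rho> x = \<rho> y"
      then have "\<sigma> (x + 1) = \<sigma> (y + 1)" using inner [of x] inner [of y] by (auto simp: \<rho>_def)
      then show "x = y" by (simp add: inj_eq [OF inj])
    qed
    moreover have "\<rho> ` {1..m} \<subseteq> {1..m}"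
    proof (rule image_subsetI)
      fix x assume "x \<in> {1..m}"
      then show "\<rho> x \<in> {1..m}" using inner [of x] by (auto simp: \<rho>_def)
    qed
    ultimately show "bij_betw \<rho> {1..m} {1..m}"
      by (simp add: bij_betw_def endo_inj_surj)
  qed
  show "\<sigma> = frame m \<rho>"
  proof
    fix i
    consider "i \<in> {2..m+1}" | "i = 1" | "i = m + 2" | "i \<notin> {1..m+2}" by fastforce
    then show "\<sigma> i = frame m \<rho> i"
    proof cases
      case 1
      then have "i - 1 \<in> {1..m}" "i - 1 + 1 = i" by auto
      then show ?thesis using inner [of "i - 1"] 1 by (simp add: frame_def \<rho>_def)
    next
      case 4
      then show ?thesis using permutes_not_in [OF p, of i] by (auto simp: frame_def)
    qed (use first last in \<open>auto simp: frame_def\<close>)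
  qed
qed

lemma bij_betw_frame: "bij_betw (frame m) (adiag_perms k m) (adiag_blocks (k + 1) (m + 2))"
proof (rule bij_betw_imageI)
  show "inj_on (frame m) (adiag_perms k m)"
  proof (rule inj_onI)
    fix \<rho> \<rho>' assume "\<rho> \<in> adiag_perms k m" "\<rho>' \<in> adiag_perms k m" and eq: "frame m \<rho> = frame m \<rho>'"
    then have p: "\<rho> permutes {1..m}" "\<rho>' permutes {1..m}" by (auto simp: adiag_permutes)
    show "\<rho> = \<rho>'"
      by (rule frame_inject [OF eq])
         (simp_all only: permutes_not_in [OF p(1)] permutes_not_in [OF p(2)] not_False_eq_True)
  qed
  show "frame m ` adiag_perms k m = adiag_blocks (k + 1) (m + 2)"
  proof
    show "frame m ` adiag_perms k m \<subseteq> adiag_blocks (k + 1) (m + 2)"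
    proof (rule image_subsetI)
      fix \<rho> assume "\<rho> \<in> adiag_perms k m"
      then show "frame m \<rho> \<in> adiag_blocks (k + 1) (m + 2)"
        using frame_adiag_iff [of \<rho> m k] adiag_permutes [of \<rho> k m]
        by (simp add: adiag_blocks_def) (simp add: frame_def)
    qed
    show "adiag_blocks (k + 1) (m + 2) \<subseteq> frame m ` adiag_perms k m"
    proof
      fix \<sigma> assume s: "\<sigma> \<in> adiag_blocks (k + 1) (m + 2)"
      obtain \<rho> where r: "\<rho> permutes {1..m}" "\<sigma> = frame m \<rho>" by (rule frame_split [OF s])
      then have "\<rho> \<in> adiag_perms k m"
        using s frame_adiag_iff [OF r(1)] by (simp add: adiag_blocks_def)
      with r show "\<sigma> \<in> frame m ` adiag_perms k m" by blast
    qed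
  qed
qed

lemma frame_invol_iff:
  assumes r: "\<rho> permutes {1..m}"
  shows "inv (frame m \<rho>) = frame m \<rho> \<longleftrightarrow> inv \<rho> = \<rho>"
proof
  assume "inv (frame m \<rho>) = frame m \<rho>"
  then have eq: "frame m (inv \<rho>) = frame m \<rho>" by (simp add: inv_frame [OF r])
  show "inv \<rho> = \<rho>"
    by (rule frame_inject [OF eq])
       (simp_all only: permutes_not_in [OF r] permutes_not_in [OF permutes_inv [OF r]]
         not_False_eq_True)
qed (simp add: inv_frame [OF r])

lemma card_adiag_blocks_frame: "card (adiag_blocks (k + 1) (m + 2)) = card (adiag_perms k m)"
  by (rule bij_betw_same_card [OF bij_betw_frame, symmetric])

lemma card_invols_fix_frame:
  "card {\<pi> \<in> adiag_invols (k + 1) (m + 2). \<pi> 1 = 1} = card (adiag_invols k m)"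
proof -
  have "bij_betw (frame m) (adiag_invols k m) {\<pi> \<in> adiag_invols (k + 1) (m + 2). \<pi> 1 = 1}"
  proof (rule bij_betw_subset [OF bij_betw_frame])
    show "adiag_invols k m \<subseteq> adiag_perms k m" by (auto simp: adiag_invols_def)
    have "{\<pi> \<in> adiag_invols (k + 1) (m + 2). \<pi> 1 = 1} =
        {\<pi> \<in> adiag_blocks (k + 1) (m + 2). inv \<pi> = \<pi>}"
      by (auto simp: adiag_invols_def adiag_blocks_def)
    also have "\<dots> = {\<pi> \<in> frame m ` adiag_perms k m. inv \<pi> = \<pi>}"
      by (simp only: bij_betw_imp_surj_on [OF bij_betw_frame])
    also have "\<dots> = frame m ` adiag_invols k m"
    proof (intro set_eqI iffI)
      fix \<pi> assume "\<pi> \<in> {\<pi> \<in> frame m ` adiag_perms k m. inv \<pi> = \<pi>}"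
      then obtain \<rho> where r: "\<rho> \<in> adiag_perms k m" "\<pi> = frame m \<rho>" "inv (frame m \<rho>) = frame m \<rho>"
        by auto
      then have "inv \<rho> = \<rho>" using frame_invol_iff [OF adiag_permutes [OF r(1)]] by simp
      then show "\<pi> \<in> frame m ` adiag_invols k m" using r by (simp add: adiag_invols_def)
    next
      fix \<pi> assume "\<pi> \<in> frame m ` adiag_invols k m"
      then obtain \<rho> where r: "\<rho> \<in> adiag_perms k m" "\<pi> = frame m \<rho>" and i: "inv \<rho> = \<rho>"
        by (auto simp: adiag_invols_def)
      have "inv (frame m \<rho>) = frame m \<rho>"
        using frame_invol_iff [OF adiag_permutes [OF r(1)]] i by simp
      then show "\<pi> \<in> {\<pi> \<in> frame m ` adiag_perms k m. inv \<pi> = \<pi>}" using r by simp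
    qed
    finally show "frame m ` adiag_invols k m = {\<pi> \<in> adiag_invols (k + 1) (m + 2). \<pi> 1 = 1}" ..
  qed
  from bij_betw_same_card [OF this] show ?thesis by simp
qed

section \<open>The smallest cases\<close>

lemma id_adiag: "id \<in> adiag_perms k m"
proof -
  have "rc m id = id" by (auto simp: rc_def fun_eq_iff)
  then show ?thesis by (simp add: adiag_perms_def permutes_id sw_bounded_def)
qed

text \<open>
  The point \<open>(1, 1)\<close> would be south-west of any inversion, so there are none.
\<close>
lemma adiag_blocks_0_eq_id:
  assumes F: "\<sigma> \<in> adiag_blocks 0 m"
  shows "\<sigma> = id"
proof -
  have X: "\<sigma> \<in> adiag_perms 0 m" and first: "\<sigma> 1 = 1"
    using F by (auto simp: adiag_blocks_def)
  have p: "\<sigma> permutes {1..m}" using X by (rule adiag_permutes)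
  have inj: "inj \<sigma>" using permutes_inj [OF p] .
  have mono: "\<sigma> i < \<sigma> j" if ij: "1 \<le> i" "i < j" "j \<le> m" for i j
  proof (rule ccontr)
    assume "\<not> \<sigma> i < \<sigma> j"
    moreover have "\<sigma> i \<noteq> \<sigma> j" "\<sigma> j \<noteq> \<sigma> 1" using ij by (simp_all add: inj_eq [OF inj])
    moreover have "1 \<le> \<sigma> j" using permutes_range [OF p, of j] ij by simp
    ultimately have *: "\<sigma> j < \<sigma> i" "1 < \<sigma> j" using first by auto
    then have "i \<noteq> 1" using first by auto
    then have "1 \<in> southwest \<sigma> i j" using * ij first by (simp add: southwest_def)
    moreover have "card (southwest \<sigma> i j) \<le> 0"
      using X ij * by (intro sw_boundedD) (auto simp: adiag_perms_def)
    ultimately show False by (simp add: card_gt_0_iff)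
  qed
  have ge: "1 \<le> i \<Longrightarrow> i \<le> m \<Longrightarrow> i \<le> \<sigma> i" for i
  proof (induction i rule: nat_induct_at_least [of 1])
    case (Suc i)
    then show ?case using mono [of i "Suc i"] by simp
  qed (simp add: first)
  show "\<sigma> = id"
    by (rule permutes_natset_ge [OF p]) (use ge in auto)
qed

lemma adiag_blocks_0: "adiag_blocks 0 m = {id}"
  using adiag_blocks_0_eq_id id_adiag by (auto simp: adiag_blocks_def)

lemma adiag_blocks_1: "adiag_blocks k 1 = {id}"
proof -
  have "\<pi> = id" if "\<pi> \<in> adiag_perms k 1" for \<pi>
    using adiag_permutes [OF that] by simp
  then show ?thesis using id_adiag by (auto simp: adiag_blocks_def)
qed

lemma adiag_perms_empty: "adiag_perms k 0 = {id}"
  using id_adiag adiag_permutes [of _ k 0] by (auto simp: permutes_empty)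

lemma invols_fix_0: "{\<pi> \<in> adiag_invols 0 m. \<pi> 1 = 1} = {id}"
  using adiag_blocks_0_eq_id [of _ m] id_adiag by (auto simp: adiag_invols_def adiag_blocks_def)

lemma adiag_invols_le_1:
  assumes "m \<le> 1"
  shows "adiag_invols k m = {id}"
proof -
  have "\<pi> = id" if "\<pi> \<in> adiag_perms k m" for \<pi>
    using adiag_permutes [OF that] assms by (cases "m = 0") (auto simp: le_less)
  then show ?thesis using id_adiag by (auto simp: adiag_invols_def)
qed

section \<open>Counting\<close>

lemma sum_power2_doubling:
  fixes f :: "nat \<Rightarrow> nat"
  assumes "f 0 = 1" "\<And>n. f (Suc n) = c + (\<Sum>j\<le>n. f j)"
  shows "f (Suc n) = (c + 1) * 2 ^ n"
proof (induction n)
  case (Suc n)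
  have "f (Suc (Suc n)) = f (Suc n) + f (Suc n)"
    using assms(2) [of n] assms(2) [of "Suc n"] by simp
  then show ?case using Suc by simp
qed (use assms(1) assms(2) [of 0] in simp)

lemma sum_reverse_from_1: "(\<Sum>a = 1..Suc n. g (Suc n - a)) = (\<Sum>j\<le>n. (g j :: nat))"
  by (rule sum.reindex_bij_witness [of _ "\<lambda>j. Suc n - j" "\<lambda>a. Suc n - a"]) auto

text \<open>
  Since all blocks are identities here, this counts the compositions of \<open>m + 1\<close>.
\<close>
lemma card_adiag_perms_0: "card (adiag_perms 0 (Suc m)) = 2 ^ m"
proof -
  have "card (adiag_perms 0 (Suc n)) = 0 + (\<Sum>j\<le>n. card (adiag_perms 0 j))" for n
  proof -
    have "card (adiag_perms 0 (Suc n)) = (\<Sum>a = 1..Suc n. card (adiag_perms 0 (Suc n - a)))"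
      using card_adiag_perms_rec [of 0 "Suc n"] by (simp add: adiag_blocks_0)
    then show ?thesis
      by (simp only: sum_reverse_from_1 [of "\<lambda>j. card (adiag_perms 0 j)"] add_0)
  qed
  from sum_power2_doubling [of "\<lambda>n. card (adiag_perms 0 n)", OF _ this]
  show ?thesis by (simp add: adiag_perms_empty)
qed

lemma card_invols_step:
  assumes "k \<le> 1" "e \<le> 1" "1 \<le> n"
  shows "card (adiag_invols k (2 * n + e)) =
    card {\<pi> \<in> adiag_invols k (2 * n + e). \<pi> 1 = 1} +
    (\<Sum>a = 1..n. card (adiag_blocks k a) * card (adiag_invols k (2 * (n - a) + e)))"
proof -
  have "(2 * n + e) div 2 = n" using assms by simp
  moreover have "2 * n + e - 2 * a = 2 * (n - a) + e" if "a \<in> {1..n}" for a using that by auto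
  ultimately show ?thesis
    using card_adiag_invols_rec [of k "2 * n + e"] assms by simp
qed

text \<open>
  Since all blocks are identities here, this counts the palindromic compositions of \<open>2 * n + e\<close>.
\<close>
lemma card_adiag_invols_0:
  assumes e: "e \<le> 1"
  shows "card (adiag_invols 0 (2 * n + e)) = 2 ^ n"
proof (cases n)
  case 0
  then show ?thesis using e by (simp add: adiag_invols_le_1)
next
  case (Suc n')
  have "card (adiag_invols 0 (2 * Suc n + e)) = 1 + (\<Sum>j\<le>n. card (adiag_invols 0 (2 * j + e)))" for n
  proof -
    have "card (adiag_invols 0 (2 * Suc n + e)) =
        1 + (\<Sum>a = 1..Suc n. card (adiag_invols 0 (2 * (Suc n - a) + e)))"
      using card_invols_step [of 0 e "Suc n"] e by (simp add: adiag_blocks_0 invols_fix_0)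
    also have "(\<Sum>a = 1..Suc n. card (adiag_invols 0 (2 * (Suc n - a) + e))) =
        (\<Sum>j\<le>n. card (adiag_invols 0 (2 * j + e)))"
      by (rule sum_reverse_from_1)
    finally show ?thesis .
  qed
  from sum_power2_doubling [of "\<lambda>n. card (adiag_invols 0 (2 * n + e))", OF _ this, of n']
  show ?thesis using e Suc by (simp add: adiag_invols_le_1)
qed

text \<open>
  Passing from \<open>n\<close> to \<open>n + 1\<close> doubles the left-hand side and adds \<open>pell n\<close>, as in the recurrence of
  the Pell numbers.
\<close>
lemma pell_as_sum: "2 ^ (n + 1) + (\<Sum>j<n. 2 ^ (n - 1 - j) * pell j) = pell (n + 1)"
proof (induction n)
  case (Suc n)
  have "(\<Sum>j<n. 2 ^ (n - j) * pell j) = 2 * (\<Sum>j<n. 2 ^ (n - 1 - j) * pell j)"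
  proof -
    have "2 ^ (n - j) * pell j = 2 * (2 ^ (n - 1 - j) * pell j)" if "j \<in> {..<n}" for j
    proof -
      have "n - j = Suc (n - 1 - j)" using that by simp
      then show ?thesis by (simp only: power_Suc mult.assoc)
    qed
    then show ?thesis unfolding sum_distrib_left by (rule sum.cong [OF refl])
  qed
  moreover have "pell (Suc n + 1) = 2 * pell (n + 1) + pell n"
    using pell.simps(3) [of n] by (simp only: Suc_eq_plus1)
  ultimately show ?case using Suc.IH by simp
qed (simp add: One_nat_def)

text \<open>
  The numbers of blocks of sizes 1, 2, 3, 4, 5, \<open>\<dots>\<close> are 1, 1, 1, 2, 4, \<open>\<dots>\<close>. The blocks of sizes 1
  and 2 contribute \<open>pell (n - 1)\<close> and \<open>pell (n - 2)\<close>; all others, together with the involutions that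
  fix 1, contribute \<open>pell (n - 1)\<close> by \<open>pell_as_sum\<close>.
\<close>
lemma card_adiag_invols_1:
  assumes e: "e \<le> 1"
  shows "card (adiag_invols 1 (2 * n + e)) = pell n"
proof (induction n rule: less_induct)
  case (less n)
  define d where "d a = card (adiag_blocks 1 a)" for a
  have d1: "d 1 = 1" by (simp add: d_def adiag_blocks_1)
  have d_frame: "d (a + 2) = card (adiag_perms 0 a)" for a
    using card_adiag_blocks_frame [of 0 a] by (simp add: d_def)
  have d2: "d 2 = 1" using d_frame [of 0] by (simp add: adiag_perms_empty)
  have d3: "d (a + 3) = 2 ^ a" for a
    using d_frame [of "Suc a"] card_adiag_perms_0 [of a] by (simp add: numeral_3_eq_3)
  have step: "card (adiag_invols 1 (2 * n + e)) = 2 ^ (n - 1) + (\<Sum>a = 1..n. d a * pell (n - a))"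
    if n: "1 \<le> n"
  proof -
    define q where "q = n - 1"
    have q: "2 * n + e = (2 * q + e) + 2" using n by (simp add: q_def)
    have "card {\<pi> \<in> adiag_invols 1 (2 * n + e). \<pi> 1 = 1} = 2 ^ q"
      using card_invols_fix_frame [of 0 "2 * q + e"] card_adiag_invols_0 [OF e, of q]
      by (simp add: q)
    moreover have "(\<Sum>a = 1..n. d a * card (adiag_invols 1 (2 * (n - a) + e))) =
        (\<Sum>a = 1..n. d a * pell (n - a))"
      using less.IH by (intro sum.cong) auto
    ultimately show ?thesis
      using card_invols_step [of 1 e n] e n by (simp add: d_def q_def)
  qed
  consider "n = 0" | "n = 1" | q where "n = q + 2"
    by (metis add_2_eq_Suc' One_nat_def not0_implies_Suc)
  then show ?case
  proof cases
    case 1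
    then show ?thesis using e by (simp add: adiag_invols_le_1)
  next
    case 2
    then show ?thesis using step d1 by (simp add: One_nat_def)
  next
    case 3
    have "{1..n} = {1, 2} \<union> {3..n}" using 3 by auto
    then have "(\<Sum>a = 1..n. d a * pell (n - a)) =
        pell (q + 1) + pell q + (\<Sum>a = 3..n. d a * pell (n - a))"
      using d1 d2 3 by (simp add: sum.union_disjoint Suc_eq_plus1 add.commute [of 1 q])
    moreover have "(\<Sum>a = 3..n. d a * pell (n - a)) = (\<Sum>j<q. 2 ^ (q - 1 - j) * pell j)"
    proof (rule sum.reindex_bij_witness [of _ "\<lambda>j. n - j" "\<lambda>a. n - a"])
      fix a assume a: "a \<in> {3..n}"
      have "q - 1 - (n - a) = a - 3" using a 3 by auto
      then show "2 ^ (q - 1 - (n - a)) * pell (n - a) = d a * pell (n - a)"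
        using d3 [of "a - 3"] a by simp
    qed (use 3 in auto)
    moreover have "pell (q + 2) = 2 * pell (q + 1) + pell q"
      using pell.simps(3) [of q] by (simp only: Suc_eq_plus1 add_2_eq_Suc')
    ultimately show ?thesis
      using step pell_as_sum [of q] 3 by (simp add: power_add)
  qed
qed

section \<open>Pattern avoidance as a bound on south-west points\<close>

lemma contains_length_4_iff:
  "contains_pattern m \<pi> [a, b, c, d] \<longleftrightarrow>
    (\<exists>w x y z. 1 \<le> w \<and> w < x \<and> x < y \<and> y < z \<and> z \<le> m \<and>
      (\<forall>i<4. \<forall>j<4. \<pi> ([w, x, y, z] ! i) < \<pi> ([w, x, y, z] ! j) \<longleftrightarrow>
         [a, b, c, d] ! i < [a, b, c, d] ! j))" (is "?L \<longleftrightarrow> ?R")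
proof
  have len: "length [a, b, c, d] = 4" by simp
  assume ?L
  then obtain f where f: "strict_mono_on {..<4} f" "f ` {..<4} \<subseteq> {1..m}"
    and o: "\<forall>i<4. \<forall>j<4. \<pi> (f i) < \<pi> (f j) \<longleftrightarrow> [a, b, c, d] ! i < [a, b, c, d] ! j"
    unfolding contains_pattern_def len by (elim exE conjE)
  have nth: "[f 0, f 1, f 2, f 3] ! i = f i" if "i < 4" for i
  proof -
    have "i = 0 \<or> i = 1 \<or> i = 2 \<or> i = 3" using that by linarith
    then show ?thesis by (auto simp: numeral_eq_Suc One_nat_def)
  qed
  have "f 0 < f 1" "f 1 < f 2" "f 2 < f 3"
    using f(1) by (auto simp: strict_mono_on_def)
  moreover have "1 \<le> f 0" "f 3 \<le> m" using f(2) by (auto simp: image_subset_iff)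
  ultimately show ?R
    using o nth by (intro exI [of _ "f 0"] exI [of _ "f 1"] exI [of _ "f 2"] exI [of _ "f 3"]) simp
next
  assume ?R
  then obtain w x y z where *: "1 \<le> w" "w < x" "x < y" "y < z" "z \<le> m"
    and o: "\<forall>i<4. \<forall>j<4. \<pi> ([w, x, y, z] ! i) < \<pi> ([w, x, y, z] ! j) \<longleftrightarrow>
         [a, b, c, d] ! i < [a, b, c, d] ! j" by blast
  have set4: "{..<4} = {0, 1, 2, 3::nat}" by auto
  show ?L unfolding contains_pattern_def
  proof (intro exI [of _ "\<lambda>i. [w, x, y, z] ! i"] conjI)
    show "strict_mono_on {..<length [a, b, c, d]} ((!) [w, x, y, z])"
      using * by (auto simp: strict_mono_on_def set4 numeral_eq_Suc One_nat_def less_Suc_eq)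
    show "(!) [w, x, y, z] ` {..<length [a, b, c, d]} \<subseteq> {1..m}"
      using * by (auto simp: set4 numeral_eq_Suc One_nat_def less_Suc_eq)
    show "\<forall>i<length [a, b, c, d]. \<forall>j<length [a, b, c, d].
        (\<pi> ([w, x, y, z] ! i) < \<pi> ([w, x, y, z] ! j)) = ([a, b, c, d] ! i < [a, b, c, d] ! j)"
      using o by (simp add: numeral_eq_Suc)
  qed
qed

lemma sw_bounded_1_iff_avoids:
  assumes p: "\<pi> permutes {1..m}"
  shows "sw_bounded 1 m \<pi> \<longleftrightarrow>
    \<not> contains_pattern m \<pi> [1,2,4,3] \<and> \<not> contains_pattern m \<pi> [2,1,4,3]"
proof
  assume S: "sw_bounded 1 m \<pi>"
  have False if "1 \<le> w" "w < x" "x < y" "y < z" "z \<le> m" "\<pi> z < \<pi> y" "\<pi> w < \<pi> z" "\<pi> x < \<pi> z"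
    for w x y z
  proof -
    have "card {w, x} \<le> card (southwest \<pi> y z)"
      by (rule card_mono) (use that in \<open>auto simp: southwest_def\<close>)
    also have "\<dots> \<le> 1" by (rule sw_boundedD [OF S]) (use that in auto)
    finally show False using that by simp
  qed
  note no = this
  show "\<not> contains_pattern m \<pi> [1,2,4,3] \<and> \<not> contains_pattern m \<pi> [2,1,4,3]"
    unfolding contains_length_4_iff
    by (auto simp: numeral_eq_Suc All_less_Suc One_nat_def intro: no)
next
  assume A: "\<not> contains_pattern m \<pi> [1,2,4,3] \<and> \<not> contains_pattern m \<pi> [2,1,4,3]"
  show "sw_bounded 1 m \<pi>"
    unfolding sw_bounded_def
  proof (intro allI impI, elim conjE, rule ccontr)
    fix i j assume ij: "1 \<le> i" "i < j" "j \<le> m" "\<pi> j < \<pi> i" and "\<not> card (southwest \<pi> i j) \<le> 1"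
    then obtain w x where wx: "w \<in> southwest \<pi> i j" "x \<in> southwest \<pi> i j" "w < x"
      by (metis card_le_Suc0_iff_eq finite_southwest linorder_neqE_nat One_nat_def)
    have "\<pi> w \<noteq> \<pi> x" using wx permutes_inj [OF p] by (auto dest: injD)
    then consider "\<pi> w < \<pi> x" | "\<pi> x < \<pi> w" by linarith
    then show False
    proof cases
      case 1
      have "contains_pattern m \<pi> [1,2,4,3]"
        unfolding contains_length_4_iff
        by (intro exI [of _ w] exI [of _ x] exI [of _ i] exI [of _ j])
           (use 1 wx ij in \<open>auto simp: southwest_def numeral_eq_Suc All_less_Suc One_nat_def\<close>)
      then show False using A by simp
    next
      case 2
      have "contains_pattern m \<pi> [2,1,4,3]"
        unfolding contains_length_4_iff
        by (intro exI [of _ w] exI [of _ x] exI [of _ i] exI [of _ j])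
           (use 2 wx ij in \<open>auto simp: southwest_def numeral_eq_Suc All_less_Suc One_nat_def\<close>)
      then show False using A by simp
    qed
  qed
qed

lemma CI_eq_adiag_invols: "CI m {[1,2,4,3], [2,1,4,3]} = adiag_invols 1 m"
  unfolding CI_def adiag_invols_def adiag_perms_def centrosymmetric_def
  using sw_bounded_1_iff_avoids [of _ m] by auto

theorem theorem3p15:
  fixes n :: nat
  assumes "n \<ge> 1"
  shows "card (CI (2 * n) {[1,2,4,3], [2,1,4,3]}) = card (CI (2 * n + 1) {[1,2,4,3], [2,1,4,3]})
       \<and> card (CI (2 * n + 1) {[1,2,4,3], [2,1,4,3]}) = pell n"
  using card_adiag_invols_1 [of 0 n] card_adiag_invols_1 [of 1 n]
  by (simp add: CI_eq_adiag_invols)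

end
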